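(* Let $\mathcal{G}$ be a graph with Euclidean edges, let $Z_{\mathcal{G}}$ be the associated auxiliary Gaussian random field on $\mathcal{G}$, and let $d_R(u,v)=\mathrm{var}(Z_{\mathcal{G}}(u)-Z_{\mathcal{G}}(v))$ be the resistance metric on $\mathcal{G}$. Let $V\sim \mathrm{Unif}(0,1)$, $\Lambda\sim\mathrm{Unif}(0,2\pi)$ and $W\sim F$, where $F$ is a probability measure on $\mathbb{R}$ with no atom at the origin, and assume that $Z_{\mathcal{G}}(\cdot)$, $V$, $\Lambda$ and $W$ are independent. Define the random field $$Y(u) := \sqrt{-2\ln(V)}\,\cos\big(Z_{\mathcal{G}}(u)W+\Lambda\big),\qquad u\in\mathcal{G}.$$ Then $Y$ has zero mean, and its covariance function is isotropic with respect to the resistance metric, i.e. $\mathrm{cov}(Y(u),Y(v))=C_Y(d_R(u,v))$, with $$C_Y(d_R(u,v)) = \int_{\mathbb{R}} \exp\left(-\frac{d_R(u,v)\,\omega^2}{2}\right)F(\mathrm{d}\omega),\qquad u,v\in\mathcal{G}.$$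
   Context: Graph with Euclidean edges: a triple $\mathcal{G}=(\mathcal{V},\mathcal{E},\{\varphi_e\}_{e\in\mathcal{E}})$ such that: (a) $(\mathcal{V},\mathcal{E})$ is a finite, simple (no repeated edges, no loops), connected graph with vertex set $\mathcal{V}$ and edge set $\mathcal{E}$; (b) each edge $e\in\mathcal{E}$ is associated with an abstract set, also denoted $e$, such that $\mathcal{V}$ and all the edge sets are mutually disjoint; (c) if $e$ joins the vertices $u,v$, then $\varphi_e$ is a bijection defined on $e\cup\{u,v\}$ that maps $e$ onto an open interval $(\underline{e},\overline{e})\subset\mathbb{R}$ and $\{u,v\}$ onto $\{\underline{e},\overline{e}\}$. Writing $u\in\mathcal{G}$ means $u\in\mathcal{V}\cup\bigcup_{e\in\mathcal{E}}e$. For $u\in e$, $\underline{u}$ and $\overline{u}$ denote the vertices joined by $e$ corresponding under $\varphi_e$ to $\underline{e}$ and $\overline{e}$; for $u\in\mathcal{V}$, $\underline{u}=\overline{u}=u$. Two vertices are neighbors if some edge joins them. Auxiliary field: $Z_{\mathcal{G}}(u)=Z_\mu(u)+\sum_{e\in\mathcal{E}}Z_e(u)$, $u\in\mathcal{G}$, where: (i) on the vertices $v_1,\dots,v_n$ of $\mathcal{G}$, $(Z_\mu(v_1),\dots,Z_\mu(v_n))^\top\sim\mathcal{N}(0,L^{-1})$. Here, for $u,v\in\mathcal{V}$, $c(u,v)=1/d_G(u,v)$ if $u,v$ are neighbors, with $d_G(u,v)$ the length $\overline{e}-\underline{e}$ of the edge $e$ joining them, and $c(u,v)=0$ otherwise;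 $c(u)=\sum_{v}c(u,v)$; $u_0\in\mathcal{V}$ is an arbitrary fixed vertex; and $L(u,v)=1+c(u_0)$ if $u=v=u_0$, $L(u,v)=c(u)$ if $u=v\neq u_0$, and $L(u,v)=-c(u,v)$ if $u\ne v$ ($L$ is strictly positive definite); (ii) $Z_\mu$ is extended to the edges by $Z_\mu(u)=(1-d(u))Z_\mu(\underline{u})+d(u)Z_\mu(\overline{u})$, where, for $u\in e$, $d(u)=(\varphi_e(u)-\underline{e})/(\overline{e}-\underline{e})$, and $d(u)=0$ for $u\in\mathcal{V}$; (iii) $Z_e(u)=B_e(\varphi_e(u))$ for $u\in e$ and $Z_e(u)=0$ otherwise, where the $B_e$, $e\in\mathcal{E}$, are mutually independent standard Brownian bridges on $[\underline{e},\overline{e}]$ with $B_e(\underline{e})=B_e(\overline{e})=0$ (centered Gaussian with covariance $(\min(s,t)-\underline{e})(\overline{e}-\max(s,t))/(\overline{e}-\underline{e})$), independent of $Z_\mu$. A random field on $\mathcal{G}$ is a collection of random variables indexed by $\mathcal{G}$ on the same probability space. A covariance function on $\mathcal{G}\times\mathcal{G}$ is isotropic with respect to $d_R$ if it depends on $(u,v)$ only through $d_R(u,v)$. *)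

theory Defs
  imports "HOL-Probability.Probability"
begin

section \<open>Graphs with Euclidean edges\<close>

text \<open>
  An edge is the unordered pair of the vertices it joins.  The abstract set associated with the
  edge \<open>e\<close> is \<open>edge_points G e\<close>, and \<open>edge_map G e\<close> is its bijection.  Vertices and points on
  edges have the same type.
\<close>

record 'a euclidean_graph =
  vertices :: "'a set"
  edges :: "'a set set"
  edge_points :: "'a set \<Rightarrow> 'a set"
  edge_map :: "'a set \<Rightarrow> 'a \<Rightarrow> real"

definition neighbors :: "'a euclidean_graph \<Rightarrow> 'a \<Rightarrow> 'a \<Rightarrow> bool" where
  "neighbors G u v \<longleftrightarrow> {u, v} \<in> edges G"

definition graph_with_euclidean_edges :: "'a euclidean_graph \<Rightarrow> bool" where
  "graph_with_euclidean_edges G \<longleftrightarrow>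
     finite (vertices G) \<and> vertices G \<noteq> {} \<and>
     edges G \<subseteq> {{u, v} | u v. u \<in> vertices G \<and> v \<in> vertices G \<and> u \<noteq> v} \<and>
     (\<forall>u\<in>vertices G. \<forall>v\<in>vertices G. (neighbors G)\<^sup>*\<^sup>* u v) \<and>
     (\<forall>e\<in>edges G. vertices G \<inter> edge_points G e = {}) \<and>
     disjoint_family_on (edge_points G) (edges G) \<and>
     (\<forall>e\<in>edges G. \<exists>a b. a < b \<and>
        inj_on (edge_map G e) (edge_points G e \<union> e) \<and>
        edge_map G e ` edge_points G e = {a<..<b} \<and>
        edge_map G e ` e = {a, b})"

definition points :: "'a euclidean_graph \<Rightarrow> 'a set" where
  "points G = vertices G \<union> (\<Union>e\<in>edges G. edge_points G e)"

text \<open>Since \<open>edge_map G e\<close> maps the two end vertices onto the two end points of the interval, the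
  latter are the minimum and maximum of the image of \<open>e\<close>.\<close>

definition edge_lo :: "'a euclidean_graph \<Rightarrow> 'a set \<Rightarrow> real" where
  "edge_lo G e = Min (edge_map G e ` e)"

definition edge_hi :: "'a euclidean_graph \<Rightarrow> 'a set \<Rightarrow> real" where
  "edge_hi G e = Max (edge_map G e ` e)"

definition containing_edge :: "'a euclidean_graph \<Rightarrow> 'a \<Rightarrow> 'a set" where
  "containing_edge G u = (THE e. e \<in> edges G \<and> u \<in> edge_points G e)"

definition lower_vertex :: "'a euclidean_graph \<Rightarrow> 'a \<Rightarrow> 'a" where
  "lower_vertex G u =
     (if u \<in> vertices G then u
      else THE v. v \<in> containing_edge G u \<and> edge_map G (containing_edge G u) v = edge_lo G (containing_edge G u))"

definition upper_vertex :: "'a euclidean_graph \<Rightarrow> 'a \<Rightarrow> 'a" where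
  "upper_vertex G u =
     (if u \<in> vertices G then u
      else THE v. v \<in> containing_edge G u \<and> edge_map G (containing_edge G u) v = edge_hi G (containing_edge G u))"

definition rel_position :: "'a euclidean_graph \<Rightarrow> 'a \<Rightarrow> real" where
  "rel_position G u =
     (if u \<in> vertices G then 0
      else (edge_map G (containing_edge G u) u - edge_lo G (containing_edge G u)) /
           (edge_hi G (containing_edge G u) - edge_lo G (containing_edge G u)))"


section \<open>The matrix \<open>L\<close>\<close>

definition conductance :: "'a euclidean_graph \<Rightarrow> 'a \<Rightarrow> 'a \<Rightarrow> real" where
  "conductance G u v =
     (if neighbors G u v then 1 / (edge_hi G {u, v} - edge_lo G {u, v}) else 0)"

definition total_conductance :: "'a euclidean_graph \<Rightarrow> 'a \<Rightarrow> real" where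
  "total_conductance G u = (\<Sum>v\<in>vertices G. conductance G u v)"

definition L_matrix :: "'a euclidean_graph \<Rightarrow> 'a \<Rightarrow> 'a \<Rightarrow> 'a \<Rightarrow> real" where
  "L_matrix G u0 u v =
     (if u = v then (if u = u0 then 1 + total_conductance G u0 else total_conductance G u)
      else - conductance G u v)"

text \<open>The inverse of a matrix indexed by a finite set, following \<^const>\<open>matrix_inv\<close>.\<close>

definition matrix_inv_on :: "'a set \<Rightarrow> ('a \<Rightarrow> 'a \<Rightarrow> real) \<Rightarrow> 'a \<Rightarrow> 'a \<Rightarrow> real" where
  "matrix_inv_on I A = (SOME B. \<forall>u\<in>I. \<forall>v\<in>I.
     (\<Sum>w\<in>I. A u w * B w v) = (if u = v then 1 else 0) \<and>
     (\<Sum>w\<in>I. B u w * A w v) = (if u = v then 1 else 0))"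


section \<open>Gaussian random fields\<close>

definition covariance :: "'w measure \<Rightarrow> ('w \<Rightarrow> real) \<Rightarrow> ('w \<Rightarrow> real) \<Rightarrow> real" where
  "covariance M X Y = prob_space.expectation M
     (\<lambda>\<omega>. (X \<omega> - prob_space.expectation M X) * (Y \<omega> - prob_space.expectation M Y))"

text \<open>Normal distributions include the degenerate ones, of variance zero.\<close>

definition normal_rv :: "'w measure \<Rightarrow> ('w \<Rightarrow> real) \<Rightarrow> bool" where
  "normal_rv M X \<longleftrightarrow> X \<in> borel_measurable M \<and>
     ((\<exists>m. AE \<omega> in M. X \<omega> = m) \<or>
      (\<exists>m \<sigma>. 0 < \<sigma> \<and> distributed M lborel X (normal_density m \<sigma>)))"

text \<open>For a finite index set \<open>T\<close> this is the multivariate normal law with mean zero and covariance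
  matrix \<open>K\<close>.\<close>

definition centered_gaussian_field ::
    "'w measure \<Rightarrow> 't set \<Rightarrow> ('t \<Rightarrow> 'w \<Rightarrow> real) \<Rightarrow> ('t \<Rightarrow> 't \<Rightarrow> real) \<Rightarrow> bool" where
  "centered_gaussian_field M T X K \<longleftrightarrow>
     (\<forall>J a. finite J \<and> J \<subseteq> T \<longrightarrow> normal_rv M (\<lambda>\<omega>. \<Sum>t\<in>J. a t * X t \<omega>)) \<and>
     (\<forall>t\<in>T. prob_space.expectation M (X t) = 0) \<and>
     (\<forall>s\<in>T. \<forall>t\<in>T. covariance M (X s) (X t) = K s t)"

text \<open>Continuity of the paths is not part of the definition.\<close>

definition brownian_bridge ::
    "'w measure \<Rightarrow> real \<Rightarrow> real \<Rightarrow> (real \<Rightarrow> 'w \<Rightarrow> real) \<Rightarrow> bool" where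
  "brownian_bridge M a b B \<longleftrightarrow>
     centered_gaussian_field M {a..b} B (\<lambda>s t. (min s t - a) * (b - max s t) / (b - a)) \<and>
     (\<forall>\<omega>\<in>space M. B a \<omega> = 0 \<and> B b \<omega> = 0)"

text \<open>The \<open>\<sigma>\<close>-algebras generated by a random variable and by a random field.  Independence is
  expressed by them, because \<^const>\<open>prob_space.indep_vars\<close> needs all values to have the same type.\<close>

definition rv_events :: "'w measure \<Rightarrow> ('w \<Rightarrow> real) \<Rightarrow> 'w set set" where
  "rv_events M X = sets (vimage_algebra (space M) X borel)"

definition field_events :: "'w measure \<Rightarrow> 't set \<Rightarrow> ('t \<Rightarrow> 'w \<Rightarrow> real) \<Rightarrow> 'w set set" where
  "field_events M T X =
     sets (vimage_algebra (space M) (\<lambda>\<omega>. \<lambda>t\<in>T. X t \<omega>) (Pi\<^sub>M T (\<lambda>_. borel)))"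


section \<open>The auxiliary random field\<close>

definition mu_field ::
    "'a euclidean_graph \<Rightarrow> ('a \<Rightarrow> 'w \<Rightarrow> real) \<Rightarrow> 'a \<Rightarrow> 'w \<Rightarrow> real" where
  "mu_field G Zv u \<omega> =
     (1 - rel_position G u) * Zv (lower_vertex G u) \<omega> + rel_position G u * Zv (upper_vertex G u) \<omega>"

definition bridge_field ::
    "'a euclidean_graph \<Rightarrow> ('a set \<Rightarrow> real \<Rightarrow> 'w \<Rightarrow> real) \<Rightarrow> 'a set \<Rightarrow> 'a \<Rightarrow> 'w \<Rightarrow> real" where
  "bridge_field G B e u \<omega> = (if u \<in> edge_points G e then B e (edge_map G e u) \<omega> else 0)"

text \<open>\<open>Zv\<close> is the Gaussian vector on the vertices.  The index \<open>None\<close> stands for \<open>Zv\<close> and \<open>Some e\<close>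
  for the bridge on \<open>e\<close>.\<close>

definition auxiliary_field ::
    "'w measure \<Rightarrow> 'a euclidean_graph \<Rightarrow> ('a \<Rightarrow> 'w \<Rightarrow> real) \<Rightarrow> bool" where
  "auxiliary_field M G Z \<longleftrightarrow> (\<exists>u0 Zv B.
     u0 \<in> vertices G \<and>
     centered_gaussian_field M (vertices G) Zv (matrix_inv_on (vertices G) (L_matrix G u0)) \<and>
     (\<forall>e\<in>edges G. brownian_bridge M (edge_lo G e) (edge_hi G e) (B e)) \<and>
     prob_space.indep_sets M
       (\<lambda>i. case i of None \<Rightarrow> field_events M (vertices G) Zv
                    | Some e \<Rightarrow> field_events M {edge_lo G e..edge_hi G e} (B e))
       (insert None (Some ` edges G)) \<and>
     (\<forall>u\<in>points G. \<forall>\<omega>\<in>space M.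
        Z u \<omega> = mu_field G Zv u \<omega> + (\<Sum>e\<in>edges G. bridge_field G B e u \<omega>)))"

definition resistance_metric :: "'w measure \<Rightarrow> ('a \<Rightarrow> 'w \<Rightarrow> real) \<Rightarrow> 'a \<Rightarrow> 'a \<Rightarrow> real" where
  "resistance_metric M Z u v = prob_space.variance M (\<lambda>\<omega>. Z u \<omega> - Z v \<omega>)"

definition isotropic_wrt ::
    "'a set \<Rightarrow> ('a \<Rightarrow> 'a \<Rightarrow> real) \<Rightarrow> ('a \<Rightarrow> 'a \<Rightarrow> real) \<Rightarrow> bool" where
  "isotropic_wrt S d K \<longleftrightarrow> (\<exists>C. \<forall>u\<in>S. \<forall>v\<in>S. K u v = C (d u v))"

end

theory Submission
  imports Defs "HOL-Real_Asymp.Real_Asymp"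
begin

text \<open>
  Put \<open>R = sqrt (- 2 * ln V)\<close>, so that \<open>R\<^sup>2\<close> has mean 2.  The product formula for cosines gives
  \<open>Y u * Y v = R\<^sup>2 * (cos ((Z u - Z v) * W) + cos ((Z u + Z v) * W + 2 * \<Lambda>)) / 2\<close>.  The uniform
  phase \<open>\<Lambda>\<close> kills the mean of the second cosine, as well as that of \<open>Y u\<close>.  The increment
  \<open>Z u - Z v\<close> is a sum of independent Gaussian variables, one from the vertices and one from each
  edge, so it is centred normal with variance \<open>d\<^sub>R(u, v)\<close> by definition of the resistance metric.
  Conditionally on \<open>W = \<omega>\<close> the first cosine thus has as mean the characteristic function
  \<open>exp (- d\<^sub>R(u, v) * \<omega>\<^sup>2 / 2)\<close>.
\<close>

section \<open>Uniform distributions\<close>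

text \<open>The density is a real function under \<open>ennreal\<close>, the form in which Bochner
  integrals against \<open>density\<close> reduce to Lebesgue integrals.\<close>

lemma uniform_measure_interval_eq_density:
  fixes a b :: real
  assumes "a < b"
  shows "uniform_measure lborel {a<..<b} =
    density lborel (\<lambda>x. ennreal (indicator {a<..<b} x / (b - a)))"
  unfolding uniform_measure_def
  using assms by (intro density_cong) (auto simp: divide_ennreal simp flip: ennreal_1 split: split_indicator)

lemma
  fixes a b :: real and f :: "real \<Rightarrow> real"
  assumes "a < b" "set_integrable lborel {a<..<b} f" and [measurable]: "f \<in> borel_measurable borel"
  shows integral_uniform_interval:
      "(LINT x|uniform_measure lborel {a<..<b}. f x) = (LBINT x=a..b. f x) / (b - a)" (is ?eq)
    and integrable_uniform_interval: "integrable (uniform_measure lborel {a<..<b}) f" (is ?int)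
proof -
  let ?g = "\<lambda>x. (1 / (b - a)) * (indicator {a<..<b} x *\<^sub>R f x)"
  have g: "(indicator {a<..<b} x / (b - a)) *\<^sub>R f x = ?g x" for x
    by simp
  have int: "integrable lborel ?g"
    using assms(2) unfolding set_integrable_def by (rule integrable_mult_right)
  show ?int
    unfolding uniform_measure_interval_eq_density[OF \<open>a < b\<close>]
    using int \<open>a < b\<close> by (subst integrable_density) (auto simp only: g, auto)
  have "(LINT x|uniform_measure lborel {a<..<b}. f x) = (LINT x|lborel. ?g x)"
    unfolding uniform_measure_interval_eq_density[OF \<open>a < b\<close>]
    using \<open>a < b\<close> by (subst integral_density) (auto simp only: g, auto)
  \<comment> \<open>The interval integral runs over an \<open>einterval\<close>, which agrees with
    \<open>{a<..<b}\<close> once both are unfolded to set comprehensions.\<close>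
  also have "\<dots> = (LBINT x=a..b. f x) / (b - a)"
    using \<open>a < b\<close>
    by (simp only: integral_mult_right_zero interval_lebesgue_integral_def set_lebesgue_integral_def)
       (simp add: einterval_def greaterThanLessThan_def greaterThan_def lessThan_def Int_def
         cong: conj_cong)
  finally show ?eq .
qed

text \<open>These are the moments of the squared radius. The integrand is nonnegative but unbounded
  at 0; the fundamental theorem for nonnegative integrands needs only one-sided limits of an
  antiderivative and yields integrability as well.\<close>

lemma
  shows integral_uniform_ln: "(LINT x|uniform_measure lborel {0<..<1}. - 2 * ln x) = (2 :: real)"
    and integrable_uniform_ln: "integrable (uniform_measure lborel {0<..<1}) (\<lambda>x::real. - 2 * ln x)"
proof -
  \<comment> \<open>An antiderivative of \<open>- 2 * ln x\<close>; its limits 0 at 0 and 2 at 1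
    give the value of the integral.\<close>
  let ?F = "\<lambda>x::real. 2 * (x - x * ln x)"
  have lim: "((?F \<circ> real_of_ereal) \<longlongrightarrow> 0) (at_right (ereal 0))"
    "((?F \<circ> real_of_ereal) \<longlongrightarrow> 2) (at_left (ereal 1))"
    unfolding ereal_tendsto_simps by real_asymp+
  have deriv: "DERIV ?F x :> - 2 * ln x" if "ereal 0 < ereal x" "ereal x < ereal 1" for x
    using that by (auto intro!: derivative_eq_intros)
  have cont: "isCont (\<lambda>x. - 2 * ln x) x" if "ereal 0 < ereal x" "ereal x < ereal 1" for x :: real
    using that by (auto intro!: continuous_intros)
  have nn: "AE x in lborel. ereal 0 < ereal x \<longrightarrow> ereal x < ereal 1 \<longrightarrow> 0 \<le> - 2 * ln x"
    by auto
  have lt: "ereal 0 < ereal 1" by simp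
  note ftc = interval_integral_FTC_nonneg[OF lt deriv cont nn lim]
  have int: "set_integrable lborel {0<..<1} (\<lambda>x::real. - 2 * ln x)"
    using ftc(1) by (simp add: einterval_eq_Icc einterval_def greaterThanLessThan_def
        greaterThan_def lessThan_def Int_def)
  show "(LINT x|uniform_measure lborel {0<..<1}. - 2 * ln x) = (2 :: real)"
    using ftc(2) by (subst integral_uniform_interval[OF _ int]) auto
  show "integrable (uniform_measure lborel {0<..<1}) (\<lambda>x::real. - 2 * ln x)"
    by (rule integrable_uniform_interval[OF _ int]) auto
qed

text \<open>An antiderivative returns to its initial value after \<open>k\<close> full periods. The
  case \<open>k = 1\<close> serves the mean of \<open>Y\<close>, the case \<open>k = 2\<close> the
  product \<open>Y u * Y v\<close>.\<close>

lemma
  fixes k :: nat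
  assumes "0 < k"
  shows integral_uniform_cos: "(LINT x|uniform_measure lborel {0<..<2 * pi}. cos (k * x)) = 0"
    and integral_uniform_sin: "(LINT x|uniform_measure lborel {0<..<2 * pi}. sin (k * x)) = 0"
proof -
  have int: "set_integrable lborel {0<..<2 * pi} f" if "continuous_on {0..2 * pi} f"
    for f :: "real \<Rightarrow> real"
    using borel_integrable_atLeastAtMost'[OF that] by (rule set_integrable_subset) auto
  have period: "cos (real k * (2 * pi)) = 1" "sin (real k * (2 * pi)) = 0"
    using cos_int_2pin[of "int k"] sin_int_2pin[of "int k"] by (simp_all add: ac_simps)
  have "(LBINT x=0..2 * pi. cos (k * x)) = sin (k * (2 * pi)) / k - sin (real k * 0) / k"
    unfolding zero_ereal_def using assms
    by (intro interval_integral_FTC_finite)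
       (auto intro!: continuous_intros derivative_eq_intros
         simp flip: has_real_derivative_iff_has_vector_derivative)
  then show "(LINT x|uniform_measure lborel {0<..<2 * pi}. cos (k * x)) = 0"
    using period by (subst integral_uniform_interval) (auto intro!: int continuous_intros simp: zero_ereal_def)
  have "(LBINT x=0..2 * pi. sin (k * x)) = - cos (k * (2 * pi)) / k - (- cos (real k * 0) / k)"
    unfolding zero_ereal_def using assms
    by (intro interval_integral_FTC_finite)
       (auto intro!: continuous_intros derivative_eq_intros
         simp flip: has_real_derivative_iff_has_vector_derivative)
  then show "(LINT x|uniform_measure lborel {0<..<2 * pi}. sin (k * x)) = 0"
    using period by (subst integral_uniform_interval) (auto intro!: int continuous_intros simp: zero_ereal_def)
qed

section \<open>Independence of generated \<open>\<sigma>\<close>-algebras\<close>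

text \<open>Grouping principle: functions of disjoint blocks of independent sources are independent.
  It works with set systems because a field and a real variable have values of different
  types.\<close>

lemma (in prob_space) indep_var_sigma:
  assumes indep: "indep_sets A I" and stable: "\<And>i. i \<in> I \<Longrightarrow> Int_stable (A i)"
    and KL: "K \<inter> L = {}" "K \<subseteq> I" "L \<subseteq> I"
    and X: "X \<in> measurable (sigma (space M) (\<Union>i\<in>K. A i)) S"
    and Y: "Y \<in> measurable (sigma (space M) (\<Union>i\<in>L. A i)) T"
  shows "indep_var S X T Y"
proof -
  have A: "A i \<subseteq> events" if "i \<in> I" for i
    using indep that by (auto simp: indep_sets_def)
  then have pow: "(\<Union>i\<in>K. A i) \<subseteq> Pow (space M)" "(\<Union>i\<in>L. A i) \<subseteq> Pow (space M)"
    using KL sets.sets_into_space by blast+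
  have "sigma_sets (space M) (\<Union>i\<in>K. A i) \<subseteq> events" "sigma_sets (space M) (\<Union>i\<in>L. A i) \<subseteq> events"
    using A KL by (auto intro!: sets.sigma_sets_subset)
  then have "random_variable S X" "random_variable T Y"
    using X Y pow measurable_mono[of S S "sigma (space M) (\<Union>i\<in>K. A i)" M]
      measurable_mono[of T T "sigma (space M) (\<Union>i\<in>L. A i)" M]
    by auto
  \<comment> \<open>Intersection-stability lets independence pass from the generators to the
    sigma-algebras generated by the two disjoint blocks.\<close>
  moreover have "indep_sets (\<lambda>j. sigma_sets (space M) (\<Union>i\<in>case_bool K L j. A i)) UNIV"
    using KL stable
    by (intro indep_sets_collect_sigma indep_sets_mono_index[OF _ indep])
       (auto simp: disjoint_family_on_def split: bool.splits)
  \<comment> \<open>By measurability, preimages under \<open>X\<close> and \<open>Y\<close> lie in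
    the sigma-algebras of their blocks, and independence is inherited by smaller systems.\<close>
  then have "indep_set (sigma_sets (space M) {X -` B \<inter> space M |B. B \<in> sets S})
      (sigma_sets (space M) {Y -` B \<inter> space M |B. B \<in> sets T})"
    unfolding indep_set_def
  proof (rule indep_sets_mono_sets)
    fix j :: bool
    have "sigma_sets (space M) {X -` B \<inter> space M |B. B \<in> sets S} \<subseteq> sigma_sets (space M) (\<Union>i\<in>K. A i)"
      using measurable_sets[OF X] pow by (intro sigma_sets_mono) auto
    moreover have "sigma_sets (space M) {Y -` B \<inter> space M |B. B \<in> sets T} \<subseteq> sigma_sets (space M) (\<Union>i\<in>L. A i)"
      using measurable_sets[OF Y] pow by (intro sigma_sets_mono) auto
    ultimately show "case_bool (sigma_sets (space M) {X -` B \<inter> space M |B. B \<in> sets S})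
        (sigma_sets (space M) {Y -` B \<inter> space M |B. B \<in> sets T}) j
      \<subseteq> sigma_sets (space M) (\<Union>i\<in>case_bool K L j. A i)"
      by (cases j) auto
  qed
  ultimately show ?thesis
    unfolding indep_var_eq by simp
qed

lemma borel_measurable_rv_events:
  assumes "rv_events M X \<subseteq> sets N" "space N = space M"
  shows "X \<in> borel_measurable N"
proof -
  have "X \<in> borel_measurable (vimage_algebra (space M) X borel)"
    by (rule measurable_vimage_algebra1) auto
  then show ?thesis
    using assms measurable_mono[of borel borel "vimage_algebra (space M) X borel" N]
    by (auto simp: rv_events_def)
qed

text \<open>\<open>X t\<close> is the restricted field followed by a coordinate projection.
  \<open>N\<close> stays general: it will be \<open>M\<close>, the sigma-algebra of the field
  itself, or one generated by several sources.\<close>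

lemma borel_measurable_field_events:
  assumes "field_events M T X \<subseteq> sets N" "space N = space M" "t \<in> T"
  shows "X t \<in> borel_measurable N"
proof -
  let ?X = "\<lambda>\<omega>. \<lambda>t\<in>T. X t \<omega>"
  let ?V = "vimage_algebra (space M) ?X (Pi\<^sub>M T (\<lambda>_. borel))"
  have "?X \<in> measurable ?V (Pi\<^sub>M T (\<lambda>_. borel))"
    by (rule measurable_vimage_algebra1) (auto simp: space_PiM)
  then have "?X \<in> measurable N (Pi\<^sub>M T (\<lambda>_. borel))"
    using assms measurable_mono[of "Pi\<^sub>M T (\<lambda>_. borel)" "Pi\<^sub>M T (\<lambda>_. borel)" ?V N]
    by (auto simp: field_events_def)
  from measurable_compose[OF this measurable_component_singleton[OF \<open>t \<in> T\<close>]]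
  show ?thesis
    using \<open>t \<in> T\<close> by simp
qed

section \<open>Centred normal variables\<close>

text \<open>Describing the law by its characteristic function, and not by a density, covers the degenerate
  case \<open>s = 0\<close>, which occurs for increments of bridges that are constantly zero.\<close>

definition centered_normal :: "'w measure \<Rightarrow> ('w \<Rightarrow> real) \<Rightarrow> real \<Rightarrow> bool" where
  "centered_normal M X s \<longleftrightarrow> X \<in> borel_measurable M \<and> integrable M (\<lambda>\<omega>. (X \<omega>)\<^sup>2) \<and>
     (LINT \<omega>|M. X \<omega>) = 0 \<and> (LINT \<omega>|M. (X \<omega>)\<^sup>2) = s \<and>
     (\<forall>t. char (distr M borel X) t = exp (- (s * t\<^sup>2 / 2)))"

lemma (in prob_space) centered_normal_integrable:
  "centered_normal M X s \<Longrightarrow> integrable M X"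
  by (auto simp: centered_normal_def intro: square_integrable_imp_integrable)

text \<open>The auxiliary field is prescribed only on \<open>space M\<close>, so its increments
  equal the sums studied below only there.\<close>

lemma centered_normal_cong:
  assumes "centered_normal M X s" "\<And>\<omega>. \<omega> \<in> space M \<Longrightarrow> X \<omega> = Y \<omega>"
  shows "centered_normal M Y s"
proof -
  have "Y \<in> borel_measurable M"
    using assms measurable_cong[of M X Y borel] by (auto simp: centered_normal_def)
  moreover have "distr M borel X = distr M borel Y"
    using assms(2) by (intro distr_cong) auto
  moreover have "(LINT \<omega>|M. X \<omega>) = (LINT \<omega>|M. Y \<omega>)"
    "(LINT \<omega>|M. (X \<omega>)\<^sup>2) = (LINT \<omega>|M. (Y \<omega>)\<^sup>2)"
    "integrable M (\<lambda>\<omega>. (X \<omega>)\<^sup>2) = integrable M (\<lambda>\<omega>. (Y \<omega>)\<^sup>2)"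
    using assms(2) by (auto intro!: Bochner_Integration.integral_cong Bochner_Integration.integrable_cong)
  ultimately show ?thesis
    using assms(1) by (simp add: centered_normal_def)
qed

lemma (in prob_space) centered_normal_zero: "centered_normal M (\<lambda>_. 0) 0"
  by (auto simp: centered_normal_def char_def integral_distr prob_space simp del: distr_const)

lemma char_distr:
  fixes X :: "'w \<Rightarrow> real"
  assumes "X \<in> borel_measurable M"
  shows "char (distr M borel X) t = (CLINT \<omega>|M. iexp (t * X \<omega>))"
  using assms unfolding char_def by (subst integral_distr) auto

lemma (in prob_space) centered_normal_AE_zero:
  assumes [measurable]: "X \<in> borel_measurable M" and "AE \<omega> in M. X \<omega> = 0"
  shows "centered_normal M X 0"
proof -
  have "integrable M (\<lambda>\<omega>. (X \<omega>)\<^sup>2)"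
    using assms(2) by (subst integrable_cong_AE[of _ _ "\<lambda>_. 0"]) auto
  moreover have "(LINT \<omega>|M. X \<omega>) = 0" "(LINT \<omega>|M. (X \<omega>)\<^sup>2) = 0"
    using assms(2) by (auto intro!: integral_eq_zero_AE elim: eventually_mono)
  moreover have "(CLINT \<omega>|M. iexp (t * X \<omega>)) = 1" for t
  proof -
    have "(CLINT \<omega>|M. iexp (t * X \<omega>)) = (CLINT \<omega>|M. 1)"
      using assms(2) by (intro integral_cong_AE) auto
    then show ?thesis by (simp add: prob_space)
  qed
  ultimately show ?thesis
    by (simp add: centered_normal_def char_distr)
qed

lemma (in prob_space) centered_normal_density:
  assumes \<sigma>: "0 < \<sigma>" and X: "distributed M lborel X (normal_density 0 \<sigma>)"
  shows "centered_normal M X (\<sigma>\<^sup>2)"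
proof -
  have [measurable]: "X \<in> borel_measurable M"
    using distributed_measurable[OF X] by simp
  have E: "expectation X = 0"
    by (rule normal_distributed_expectation[OF \<sigma> X])
  have "integrable M (\<lambda>\<omega>. (X \<omega>)\<^sup>2)"
    using integrable_normal_moment[OF \<sigma>, of 0 2] distributed_integrable[OF X, of "\<lambda>x. x\<^sup>2"]
    by simp
  moreover have "(LINT \<omega>|M. (X \<omega>)\<^sup>2) = \<sigma>\<^sup>2"
    using normal_distributed_variance[OF \<sigma> X] by (simp add: E)
  moreover have "char (distr M borel X) t = exp (- (\<sigma>\<^sup>2 * t\<^sup>2 / 2))" for t
  proof -
    \<comment> \<open>Standardizing reduces the claim to the characteristic function of the standard
      normal law at \<open>t * \<sigma>\<close>.\<close>
    let ?S = "\<lambda>\<omega>. X \<omega> / \<sigma>"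
    have S: "distributed M lborel ?S std_normal_density"
      using X by (simp add: normal_standard_normal_convert[OF \<sigma>])
    have "char (distr M borel X) t = (CLINT \<omega>|M. iexp ((t * \<sigma>) * ?S \<omega>))"
      using \<sigma> by (simp add: char_distr)
    also have "\<dots> = char (distr M lborel ?S) (t * \<sigma>)"
      unfolding char_def by (subst integral_distr) auto
    also have "\<dots> = exp (- (\<sigma>\<^sup>2 * t\<^sup>2 / 2))"
      by (simp add: distributed_distr_eq_density[OF S] char_std_normal_distribution power_mult_distrib
          mult.commute)
    finally show ?thesis .
  qed
  ultimately show ?thesis
    using E by (simp add: centered_normal_def)
qed

text \<open>A Gaussian field is only said to have expectations 0, which is also the default value
  for a nonintegrable function; linearity of expectation requires true integrability.\<close>

lemma (in prob_space) normal_rv_integrable: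
  assumes "normal_rv M X"
  shows "integrable M X"
proof -
  have [measurable]: "X \<in> borel_measurable M"
    using assms by (simp add: normal_rv_def)
  consider m where "AE \<omega> in M. X \<omega> = m"
    | m \<sigma> where "0 < \<sigma>" "distributed M lborel X (normal_density m \<sigma>)"
    using assms by (auto simp: normal_rv_def)
  then show ?thesis
  proof cases
    case 1
    then show ?thesis
      by (subst integrable_cong_AE[of _ _ "\<lambda>_. m"]) auto
  next
    case 2
    then show ?thesis
      using distributed_integrable[of M lborel X "normal_density m \<sigma>" "\<lambda>x. x"]
        integrable_normal_moment_nz_1[of \<sigma> m]
      by simp
  qed
qed

text \<open>In the degenerate and in the density case alike, the parameter \<open>m\<close> is the
  mean and hence 0.\<close>

lemma (in prob_space) normal_rv_centered_normal:
  assumes "normal_rv M X" "expectation X = 0"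
  obtains s where "centered_normal M X s"
proof -
  have [measurable]: "X \<in> borel_measurable M"
    using assms by (simp add: normal_rv_def)
  consider m where "AE \<omega> in M. X \<omega> = m"
    | m \<sigma> where "0 < \<sigma>" "distributed M lborel X (normal_density m \<sigma>)"
    using assms by (auto simp: normal_rv_def)
  then show ?thesis
  proof cases
    case 1
    then have "expectation X = (LINT \<omega>|M. m)"
      by (intro integral_cong_AE) auto
    with assms 1 have "AE \<omega> in M. X \<omega> = 0"
      by (simp add: prob_space)
    then show ?thesis
      by (intro that[OF centered_normal_AE_zero]) auto
  next
    case 2
    with assms normal_distributed_expectation[OF 2] have "m = 0"
      by simp
    with 2 show ?thesis
      using that centered_normal_density by blast
  qed
qed

text \<open>Independence makes the cross term of the square vanish in mean and the characteristic
  functions multiply.\<close>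

lemma (in prob_space) centered_normal_add:
  assumes indep: "indep_var borel X borel Y"
    and X: "centered_normal M X s" and Y: "centered_normal M Y r"
  shows "centered_normal M (\<lambda>\<omega>. X \<omega> + Y \<omega>) (s + r)"
proof -
  note [simp] = centered_normal_integrable[OF X] centered_normal_integrable[OF Y]
  note XY = X[unfolded centered_normal_def] Y[unfolded centered_normal_def]
  have int: "integrable M (\<lambda>\<omega>. X \<omega> * Y \<omega>)"
    by (rule indep_var_integrable[OF indep]) auto
  have "(LINT \<omega>|M. X \<omega> * Y \<omega>) = 0"
    using XY by (subst indep_var_lebesgue_integral[OF indep]) auto
  then have "(LINT \<omega>|M. (X \<omega> + Y \<omega>)\<^sup>2) = s + r" "integrable M (\<lambda>\<omega>. (X \<omega> + Y \<omega>)\<^sup>2)"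
    using XY int by (auto simp: power2_sum mult.assoc)
  moreover have "char (distr M borel (\<lambda>\<omega>. X \<omega> + Y \<omega>)) t = exp (- ((s + r) * t\<^sup>2 / 2))" for t
    using XY
    by (subst char_distr_add[OF indep])
      (simp add: ring_distribs add_divide_distrib diff_divide_distrib flip: exp_add of_real_mult)
  ultimately show ?thesis
    using XY unfolding centered_normal_def by auto
qed

text \<open>Induction on \<open>I\<close>: the new summand is independent of the sum of the
  others.\<close>

lemma (in prob_space) centered_normal_sum:
  assumes "finite I" "indep_vars (\<lambda>_. borel) X I" "\<And>i. i \<in> I \<Longrightarrow> \<exists>s. centered_normal M (X i) s"
  shows "\<exists>s. centered_normal M (\<lambda>\<omega>. \<Sum>i\<in>I. X i \<omega>) s"
  using assms
proof (induction I)
  case empty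
  then show ?case
    using centered_normal_zero by auto
next
  case (insert i I)
  have "indep_vars (\<lambda>_. borel) X I"
    using insert.prems(1) by (rule indep_vars_subset) auto
  with insert obtain s r where "centered_normal M (X i) s" "centered_normal M (\<lambda>\<omega>. \<Sum>i\<in>I. X i \<omega>) r"
    by fastforce
  from centered_normal_add[OF indep_vars_sum[OF insert.hyps insert.prems(1)] this]
  show ?case
    using insert.hyps by auto
qed

section \<open>Finite linear combinations of the variables of a field\<close>

text \<open>The sums are those of \<open>centered_gaussian_field\<close>. Equality holds at every
  sample point, so that the events of \<open>D\<close> belong to the sigma-algebra of the
  field.\<close>

definition lincomb :: "'t set \<Rightarrow> ('t \<Rightarrow> 'w \<Rightarrow> real) \<Rightarrow> ('w \<Rightarrow> real) \<Rightarrow> bool" where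
  "lincomb T X D \<longleftrightarrow> (\<exists>J a. finite J \<and> J \<subseteq> T \<and> D = (\<lambda>\<omega>. \<Sum>t\<in>J. a t * X t \<omega>))"

lemma lincomb_zero: "lincomb T X (\<lambda>_. 0)"
  unfolding lincomb_def by (rule exI[of _ "{}"]) auto

lemma lincomb_base: "t \<in> T \<Longrightarrow> lincomb T X (X t)"
  unfolding lincomb_def by (rule exI[of _ "{t}"], rule exI[of _ "\<lambda>_. 1"]) auto

lemma lincomb_mult: "lincomb T X D \<Longrightarrow> lincomb T X (\<lambda>\<omega>. c * D \<omega>)"
  unfolding lincomb_def
  by (elim exE conjE, rule_tac x=J in exI, rule_tac x="\<lambda>t. c * a t" in exI)
     (auto simp: sum_distrib_left mult.assoc)

lemma lincomb_add:
  assumes "lincomb T X D" "lincomb T X E"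
  shows "lincomb T X (\<lambda>\<omega>. D \<omega> + E \<omega>)"
proof -
  obtain J a K b where J: "finite J" "J \<subseteq> T" "D = (\<lambda>\<omega>. \<Sum>t\<in>J. a t * X t \<omega>)"
    and K: "finite K" "K \<subseteq> T" "E = (\<lambda>\<omega>. \<Sum>t\<in>K. b t * X t \<omega>)"
    using assms unfolding lincomb_def by blast
  \<comment> \<open>Both coefficient families are extended by 0 so that the two sums run over the
    same set \<open>J \<union> K\<close>.\<close>
  let ?c = "\<lambda>t. (if t \<in> J then a t else 0) + (if t \<in> K then b t else 0)"
  have "D \<omega> + E \<omega> = (\<Sum>t\<in>J \<union> K. ?c t * X t \<omega>)" for \<omega>
  proof -
    have "D \<omega> = (\<Sum>t\<in>J \<union> K. (if t \<in> J then a t else 0) * X t \<omega>)"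
      unfolding J(3) using J(1) K(1) by (intro sum.mono_neutral_cong_left) auto
    moreover have "E \<omega> = (\<Sum>t\<in>J \<union> K. (if t \<in> K then b t else 0) * X t \<omega>)"
      unfolding K(3) using J(1) K(1) by (intro sum.mono_neutral_cong_left) auto
    ultimately show ?thesis
      by (simp add: ring_distribs sum.distrib)
  qed
  then show ?thesis
    using J K unfolding lincomb_def by (intro exI[of _ "J \<union> K"] exI[of _ ?c]) auto
qed

lemma lincomb_diff:
  "lincomb T X D \<Longrightarrow> lincomb T X E \<Longrightarrow> lincomb T X (\<lambda>\<omega>. D \<omega> - E \<omega>)"
  using lincomb_add[of T X D "\<lambda>\<omega>. (- 1) * E \<omega>"] lincomb_mult[of T X E "- 1"] by simp

lemma borel_measurable_lincomb:
  assumes "lincomb T X D" "\<And>t. t \<in> T \<Longrightarrow> X t \<in> borel_measurable N"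
  shows "D \<in> borel_measurable N"
  using assms unfolding lincomb_def by (fastforce intro!: borel_measurable_sum borel_measurable_times)

lemma (in prob_space) centered_gaussian_field_lincomb:
  assumes X: "centered_gaussian_field M T X K" and D: "lincomb T X D"
  shows "\<exists>s. centered_normal M D s"
proof -
  obtain J a where J: "finite J" "J \<subseteq> T" "D = (\<lambda>\<omega>. \<Sum>t\<in>J. a t * X t \<omega>)"
    using D unfolding lincomb_def by blast
  have normal: "normal_rv M (\<lambda>\<omega>. \<Sum>t\<in>J. a t * X t \<omega>)" if "finite J" "J \<subseteq> T" for J a
    using X that by (simp add: centered_gaussian_field_def)
  \<comment> \<open>The combination over \<open>{t}\<close> with coefficient 1 is \<open>X t\<close>
    itself, hence normal.\<close>
  have "integrable M (X t)" if "t \<in> J" for t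
    using normal_rv_integrable[OF normal[of "{t}" "\<lambda>_. 1"]] that J by auto
  moreover have "expectation (X t) = 0" if "t \<in> J" for t
    using X J that by (auto simp: centered_gaussian_field_def)
  ultimately have "expectation D = 0"
    unfolding J(3) by (subst Bochner_Integration.integral_sum) auto
  then show ?thesis
    using normal_rv_centered_normal normal[OF J(1,2)] unfolding J(3) by blast
qed

section \<open>Expectations of cosines of independent variables\<close>

text \<open>With \<open>W\<close> frozen at \<open>w\<close>, the mean of the cosine is the real
  part of the characteristic function of \<open>D\<close> at \<open>w\<close>; it remains to average
  over \<open>w\<close>.\<close>

lemma (in prob_space) expectation_cos_centered_normal_mult:
  assumes D: "centered_normal M D s" and indep: "indep_var borel D borel W"
  shows "expectation (\<lambda>\<omega>. cos (D \<omega> * W \<omega>)) = (LINT w|distr M borel W. exp (- (s * w\<^sup>2 / 2)))"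
proof -
  have [measurable]: "D \<in> borel_measurable M" "W \<in> borel_measurable M"
    using indep by (auto dest: indep_var_rv1 indep_var_rv2)
  interpret D: prob_space "distr M borel D" by (rule prob_space_distr) simp
  interpret W: prob_space "distr M borel W" by (rule prob_space_distr) simp
  interpret P: pair_prob_space "distr M borel D" "distr M borel W" ..
  have Re_char: "(LINT d|distr M borel D. cos (d * w)) = exp (- (s * w\<^sup>2 / 2))" for w
  proof -
    have "integrable (distr M borel D) (\<lambda>d. iexp (w * d))"
      by (intro D.integrable_const_bound[of _ 1]) auto
    from integral_Re[OF this]
    have "(LINT d|distr M borel D. cos (d * w)) = Re (char (distr M borel D) w)"
      by (simp add: char_def Re_exp mult.commute)
    then show ?thesis
      using D by (simp add: centered_normal_def)
  qed
  have "expectation (\<lambda>\<omega>. cos (D \<omega> * W \<omega>)) =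
    (LINT p|distr M (borel \<Otimes>\<^sub>M borel) (\<lambda>\<omega>. (D \<omega>, W \<omega>)). (case p of (d, w) \<Rightarrow> cos (d * w)))"
    by (subst integral_distr) auto
  \<comment> \<open>Independence turns the joint law into a product; Fubini then applies because the
    cosine is bounded.\<close>
  also have "\<dots> = (LINT p|(distr M borel D \<Otimes>\<^sub>M distr M borel W). (case p of (d, w) \<Rightarrow> cos (d * w)))"
    using indep unfolding indep_var_distribution_eq by simp
  also have "\<dots> = (LINT w|distr M borel W. (LINT d|distr M borel D. cos (d * w)))"
    by (intro P.integral_snd[symmetric] P.integrable_const_bound[of _ 1]) (auto simp: split_beta)
  finally show ?thesis
    by (simp add: Re_char)
qed

text \<open>By the addition formula, both resulting products factor in mean, each with a vanishing
  factor coming from \<open>U\<close>.\<close>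

lemma (in prob_space) expectation_cos_add_indep:
  fixes X U :: "'a \<Rightarrow> real"
  assumes indep: "indep_var borel X borel U"
    and U: "expectation (\<lambda>\<omega>. cos (U \<omega>)) = 0" "expectation (\<lambda>\<omega>. sin (U \<omega>)) = 0"
  shows "expectation (\<lambda>\<omega>. cos (X \<omega> + U \<omega>)) = 0"
proof -
  have [measurable]: "X \<in> borel_measurable M" "U \<in> borel_measurable M"
    using indep by (auto dest: indep_var_rv1 indep_var_rv2)
  have int: "integrable M (\<lambda>\<omega>. cos (f \<omega>))" "integrable M (\<lambda>\<omega>. sin (f \<omega>))"
    if "f \<in> borel_measurable M" for f :: "'a \<Rightarrow> real"
    using that by (auto intro!: integrable_const_bound[of _ 1])
  have [measurable]: "(cos :: real \<Rightarrow> real) \<in> borel_measurable borel" "(sin :: real \<Rightarrow> real) \<in> borel_measurable borel"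
    by (auto intro!: borel_measurable_continuous_onI continuous_intros)
  have c: "indep_var borel (\<lambda>\<omega>. cos (X \<omega>)) borel (\<lambda>\<omega>. cos (U \<omega>))"
    by (rule indep_var_compose[unfolded comp_def, OF indep]) measurable
  have s: "indep_var borel (\<lambda>\<omega>. sin (X \<omega>)) borel (\<lambda>\<omega>. sin (U \<omega>))"
    by (rule indep_var_compose[unfolded comp_def, OF indep]) measurable
  have "expectation (\<lambda>\<omega>. cos (X \<omega> + U \<omega>)) =
    expectation (\<lambda>\<omega>. cos (X \<omega>) * cos (U \<omega>)) - expectation (\<lambda>\<omega>. sin (X \<omega>) * sin (U \<omega>))"
    unfolding cos_add
    by (intro Bochner_Integration.integral_diff indep_var_integrable[OF c] indep_var_integrable[OF s])
       (auto intro!: int)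
  also have "\<dots> = 0"
    by (subst indep_var_lebesgue_integral[OF c], simp_all add: int)
       (subst indep_var_lebesgue_integral[OF s], simp_all add: int U)
  finally show ?thesis .
qed

section \<open>Increments of the auxiliary field\<close>

lemma
  assumes G: "graph_with_euclidean_edges G"
  shows finite_edges: "finite (edges G)"
    and edge_subset_vertices: "e \<in> edges G \<Longrightarrow> e \<subseteq> vertices G"
proof -
  have "edges G \<subseteq> {{u, v} | u v. u \<in> vertices G \<and> v \<in> vertices G \<and> u \<noteq> v}" "finite (vertices G)"
    using G by (simp_all add: graph_with_euclidean_edges_def)
  then show "finite (edges G)" "e \<in> edges G \<Longrightarrow> e \<subseteq> vertices G"
    by (auto intro: finite_subset[of _ "Pow (vertices G)"])
qed

text \<open>\<open>edge_lo\<close> and \<open>edge_hi\<close> are the end points of the interval,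
  and injectivity of the edge map makes the corresponding vertices unique, so the definite
  descriptions are meaningful.\<close>

lemma
  assumes G: "graph_with_euclidean_edges G" and e: "e \<in> edges G"
  shows edge_map_mem_interval:
      "u \<in> edge_points G e \<Longrightarrow> edge_map G e u \<in> {edge_lo G e..edge_hi G e}"
    and ex1_lower_vertex: "\<exists>!v. v \<in> e \<and> edge_map G e v = edge_lo G e"
    and ex1_upper_vertex: "\<exists>!v. v \<in> e \<and> edge_map G e v = edge_hi G e"
proof -
  obtain a b where ab: "a < b" "inj_on (edge_map G e) (edge_points G e \<union> e)"
    "edge_map G e ` edge_points G e = {a<..<b}" "edge_map G e ` e = {a, b}"
    using G e unfolding graph_with_euclidean_edges_def by meson
  have lohi: "edge_lo G e = a" "edge_hi G e = b"
    using ab(1) by (simp_all add: edge_lo_def edge_hi_def ab(4))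
  show "edge_map G e u \<in> {edge_lo G e..edge_hi G e}" if "u \<in> edge_points G e"
    using imageI[OF that, of "edge_map G e"] by (simp add: ab(3) lohi)
  have ex1: "\<exists>!v. v \<in> e \<and> edge_map G e v = x" if "x \<in> edge_map G e ` e" for x
    using that ab(2) by (auto dest: inj_onD)
  show "\<exists>!v. v \<in> e \<and> edge_map G e v = edge_lo G e" "\<exists>!v. v \<in> e \<and> edge_map G e v = edge_hi G e"
    by (rule ex1; simp add: ab(4) lohi)+
qed

lemma
  assumes G: "graph_with_euclidean_edges G" and u: "u \<in> points G"
  shows lower_vertex_in_vertices: "lower_vertex G u \<in> vertices G"
    and upper_vertex_in_vertices: "upper_vertex G u \<in> vertices G"
proof -
  have "lower_vertex G u \<in> vertices G \<and> upper_vertex G u \<in> vertices G"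
  proof (cases "u \<in> vertices G")
    case True
    then show ?thesis
      by (simp add: lower_vertex_def upper_vertex_def)
  next
    case False
    then obtain e where e: "e \<in> edges G" "u \<in> edge_points G e"
      using u by (auto simp: points_def)
    \<comment> \<open>Disjointness of the edge sets shows that \<open>e\<close> is the only edge
      whose points include \<open>u\<close>.\<close>
    have "disjoint_family_on (edge_points G) (edges G)"
      using G by (simp add: graph_with_euclidean_edges_def)
    then have "containing_edge G u = e"
      unfolding containing_edge_def using e by (intro the_equality) (auto simp: disjoint_family_on_def)
    then show ?thesis
      using theI'[OF ex1_lower_vertex[OF G e(1)]] theI'[OF ex1_upper_vertex[OF G e(1)]]
        edge_subset_vertices[OF G e(1)] False
      by (auto simp: lower_vertex_def upper_vertex_def)
  qed
  then show "lower_vertex G u \<in> vertices G" "upper_vertex G u \<in> vertices G"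
    by auto
qed

lemma lincomb_mu_field:
  assumes "graph_with_euclidean_edges G" "u \<in> points G"
  shows "lincomb (vertices G) Zv (mu_field G Zv u)"
proof -
  have "lincomb (vertices G) Zv (\<lambda>\<omega>. (1 - rel_position G u) * Zv (lower_vertex G u) \<omega> +
      rel_position G u * Zv (upper_vertex G u) \<omega>)"
    by (intro lincomb_add lincomb_mult lincomb_base lower_vertex_in_vertices
        upper_vertex_in_vertices assms)
  then show ?thesis
    by (simp add: mu_field_def[abs_def])
qed

text \<open>On \<open>e\<close> this is a single value of the bridge, elsewhere the empty
  combination.\<close>

lemma lincomb_bridge_field:
  assumes "graph_with_euclidean_edges G" "e \<in> edges G"
  shows "lincomb {edge_lo G e..edge_hi G e} (B e) (bridge_field G B e u)"
proof (cases "u \<in> edge_points G e")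
  case True
  then have "bridge_field G B e u = B e (edge_map G e u)"
    by (auto simp: bridge_field_def)
  then show ?thesis
    using edge_map_mem_interval[OF assms True] by (auto intro: lincomb_base)
next
  case False
  then have "bridge_field G B e u = (\<lambda>_. 0)"
    by (auto simp: bridge_field_def)
  then show ?thesis
    by (simp add: lincomb_zero)
qed

text \<open>Through this inclusion, independence of whole fields descends to combinations of their
  values.\<close>

lemma vimage_lincomb_in_field_events:
  assumes "lincomb T X D" "A \<in> sets borel"
  shows "D -` A \<inter> space M \<in> field_events M T X"
proof -
  let ?N = "vimage_algebra (space M) (\<lambda>\<omega>. \<lambda>t\<in>T. X t \<omega>) (Pi\<^sub>M T (\<lambda>_. borel))"
  have "D \<in> borel_measurable ?N"
    using assms(1)
    by (rule borel_measurable_lincomb)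
       (rule borel_measurable_field_events[of M], auto simp: field_events_def)
  from measurable_sets[OF this assms(2)] show ?thesis
    by (simp add: field_events_def)
qed

text \<open>The value of \<open>s\<close> is left open: being the second moment of a centred
  increment, it is later identified with the resistance metric.\<close>

lemma (in prob_space) centered_normal_auxiliary_field_increment:
  assumes G: "graph_with_euclidean_edges G" and Z: "auxiliary_field M G Z"
    and uv: "u \<in> points G" "v \<in> points G"
  shows "\<exists>s. centered_normal M (\<lambda>\<omega>. Z u \<omega> - Z v \<omega>) s"
proof -
  obtain u0 Zv B where
    Zv: "centered_gaussian_field M (vertices G) Zv (matrix_inv_on (vertices G) (L_matrix G u0))"
    and B: "\<And>e. e \<in> edges G \<Longrightarrow> brownian_bridge M (edge_lo G e) (edge_hi G e) (B e)"
    and indep: "indep_sets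
       (\<lambda>i. case i of None \<Rightarrow> field_events M (vertices G) Zv
                    | Some e \<Rightarrow> field_events M {edge_lo G e..edge_hi G e} (B e))
       (insert None (Some ` edges G))"
    and Z_eq: "\<And>u \<omega>. u \<in> points G \<Longrightarrow> \<omega> \<in> space M \<Longrightarrow>
       Z u \<omega> = mu_field G Zv u \<omega> + (\<Sum>e\<in>edges G. bridge_field G B e u \<omega>)"
    using Z unfolding auxiliary_field_def by blast
  \<comment> \<open>The increment is split by source: \<open>None\<close> carries the vertex part,
    \<open>Some e\<close> the part of the bridge on \<open>e\<close>. Each is a linear combination
    within its own source.\<close>
  define X where "X i = (case i of
      None \<Rightarrow> \<lambda>\<omega>. mu_field G Zv u \<omega> - mu_field G Zv v \<omega>
    | Some e \<Rightarrow> \<lambda>\<omega>. bridge_field G B e u \<omega> - bridge_field G B e v \<omega>)" for i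
  let ?I = "insert None (Some ` edges G)"
  have X_None: "lincomb (vertices G) Zv (X None)"
    unfolding X_def by (auto intro!: lincomb_diff lincomb_mu_field G uv)
  have X_Some: "lincomb {edge_lo G e..edge_hi G e} (B e) (X (Some e))" if "e \<in> edges G" for e
    unfolding X_def using that by (auto intro!: lincomb_diff lincomb_bridge_field G)
  have normal: "\<exists>s. centered_normal M (X i) s" if "i \<in> ?I" for i
    using that centered_gaussian_field_lincomb[OF Zv X_None]
      centered_gaussian_field_lincomb[OF _ X_Some] B
    by (auto simp: brownian_bridge_def)
  moreover have "indep_vars (\<lambda>_. borel) X ?I"
    unfolding indep_vars_def2
  proof (intro conjI ballI indep_sets_mono_sets[OF indep])
    fix i assume i: "i \<in> ?I"
    show "random_variable borel (X i)"
      using normal[OF i] by (auto simp: centered_normal_def)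
    show "{X i -` A \<inter> space M |A. A \<in> sets borel} \<subseteq>
        (case i of None \<Rightarrow> field_events M (vertices G) Zv
           | Some e \<Rightarrow> field_events M {edge_lo G e..edge_hi G e} (B e))"
      using i vimage_lincomb_in_field_events[OF X_None] vimage_lincomb_in_field_events[OF X_Some]
      by auto
  qed
  ultimately obtain s where "centered_normal M (\<lambda>\<omega>. \<Sum>i\<in>?I. X i \<omega>) s"
    using centered_normal_sum[of ?I X] finite_edges[OF G] by blast
  moreover have "(\<Sum>i\<in>?I. X i \<omega>) = Z u \<omega> - Z v \<omega>" if "\<omega> \<in> space M" for \<omega>
    using that uv finite_edges[OF G]
    by (subst sum.insert) (auto simp: X_def Z_eq sum.reindex sum_subtractf)
  ultimately have "centered_normal M (\<lambda>\<omega>. Z u \<omega> - Z v \<omega>) s"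
    by (rule centered_normal_cong)
  then show ?thesis
    by blast
qed

section \<open>The covariance function\<close>

text \<open>Integrability accompanies the moments because expectations of nonintegrable functions
  are 0 by default.\<close>

theorem proposition3p1:
  fixes M :: "'w measure"
    and G :: "'a euclidean_graph"
    and Z Y :: "'a \<Rightarrow> 'w \<Rightarrow> real"
    and V \<Lambda> W :: "'w \<Rightarrow> real"
    and F :: "real measure"
  assumes M: "prob_space M"
    and G: "graph_with_euclidean_edges G"
    and Z: "auxiliary_field M G Z"
    and V: "V \<in> borel_measurable M" "distr M borel V = uniform_measure lborel {0<..<1}"
    and \<Lambda>: "\<Lambda> \<in> borel_measurable M" "distr M borel \<Lambda> = uniform_measure lborel {0<..<2 * pi}"
    and F: "prob_space F" "sets F = sets borel" "measure F {0} = 0"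
    and W: "W \<in> borel_measurable M" "distr M borel W = F"
    and indep: "prob_space.indep_sets M
      (nth [field_events M (points G) Z, rv_events M V, rv_events M \<Lambda>, rv_events M W]) {..<4}"
    and Y: "\<And>u \<omega>. u \<in> points G \<Longrightarrow> \<omega> \<in> space M \<Longrightarrow>
      Y u \<omega> = sqrt (- 2 * ln (V \<omega>)) * cos (Z u \<omega> * W \<omega> + \<Lambda> \<omega>)"
  shows "(\<forall>u\<in>points G. integrable M (Y u) \<and> prob_space.expectation M (Y u) = 0) \<and>
    (\<forall>u\<in>points G. \<forall>v\<in>points G. integrable M (\<lambda>\<omega>. Y u \<omega> * Y v \<omega>)) \<and>
    isotropic_wrt (points G) (resistance_metric M Z) (\<lambda>u v. covariance M (Y u) (Y v)) \<and>
    (\<forall>u\<in>points G. \<forall>v\<in>points G. covariance M (Y u) (Y v) =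
       (LINT \<omega>|F. exp (- (resistance_metric M Z u v * \<omega>\<^sup>2 / 2))))"
proof -
  interpret prob_space M by (rule M)

  \<comment> \<open>The four independent sources and the sigma-algebras they generate\<close>
  \<comment> \<open>Sources are numbered 0 for the field, 1 for \<open>V\<close>, 2 for
    \<open>\<Lambda>\<close>, 3 for \<open>W\<close>; \<open>S K\<close> is generated by those with
    number in \<open>K\<close>. Independence of two quantities is read off from disjoint index
    sets.\<close>
  define A where "A = nth [field_events M (points G) Z, rv_events M V, rv_events M \<Lambda>, rv_events M W]"
  define S where "S K = sigma (space M) (\<Union>i\<in>K. A i)" for K
  have A: "A 0 = field_events M (points G) Z" "A 1 = rv_events M V" "A 2 = rv_events M \<Lambda>"
    "A 3 = rv_events M W"
    by (simp_all add: A_def numeral_2_eq_2 numeral_3_eq_3)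
  have lessThan_4: "{..<4} = {0, 1, 2, 3 :: nat}"
    by auto
  have stable: "Int_stable (A i)" if "i \<in> {..<4}" for i
    using that unfolding lessThan_4
    by (elim insertE emptyE) (simp_all add: A field_events_def rv_events_def sets.Int_stable del: One_nat_def)
  have events: "A i \<subseteq> events" if "i \<in> {..<4}" for i
    using indep that by (simp add: indep_sets_def A_def)
  have pow: "(\<Union>i\<in>K. A i) \<subseteq> Pow (space M)" if "K \<subseteq> {..<4}" for K
    using subset_trans[OF events sets.space_closed] that by blast
  have indepI: "indep_var borel f borel g"
    if "f \<in> borel_measurable (S K)" "g \<in> borel_measurable (S L)"
      "K \<inter> L = {}" "K \<subseteq> {..<4}" "L \<subseteq> {..<4}"
    for K L and f g :: "'w \<Rightarrow> real"
    using indep_var_sigma[OF indep[folded A_def] stable that(3-5) that(1,2)[unfolded S_def]] .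
  have sets_S: "A i \<subseteq> sets (S K)" if "i \<in> K" "K \<subseteq> {..<4}" for i K
    using that pow[of K] by (auto simp: S_def)
  have space_S: "space (S K) = space M" for K
    by (simp add: S_def space_measure_of_conv)
  have ZS: "Z u \<in> borel_measurable (S K)" if "0 \<in> K" "K \<subseteq> {..<4}" "u \<in> points G" for K u
    using sets_S[OF that(1,2)] space_S that(3) unfolding A by (rule borel_measurable_field_events)
  have VS: "V \<in> borel_measurable (S K)" if "1 \<in> K" "K \<subseteq> {..<4}" for K
    using sets_S[OF that] space_S unfolding A by (rule borel_measurable_rv_events)
  have \<Lambda>S: "\<Lambda> \<in> borel_measurable (S K)" if "2 \<in> K" "K \<subseteq> {..<4}" for K
    using sets_S[OF that] space_S unfolding A by (rule borel_measurable_rv_events)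
  have WS: "W \<in> borel_measurable (S K)" if "3 \<in> K" "K \<subseteq> {..<4}" for K
    using sets_S[OF that] space_S unfolding A by (rule borel_measurable_rv_events)
  note [measurable] = V(1) \<Lambda>(1) W(1)
  have ZM [measurable]: "Z u \<in> borel_measurable M" if "u \<in> points G" for u
    using events[of 0] that unfolding A by (intro borel_measurable_field_events) auto

  \<comment> \<open>Moments of the radial factor\<close>
  define R where "R \<omega> = sqrt (- 2 * ln (V \<omega>))" for \<omega>
  have Y_R: "Y u \<omega> = R \<omega> * cos (Z u \<omega> * W \<omega> + \<Lambda> \<omega>)" if "u \<in> points G" "\<omega> \<in> space M" for u \<omega>
    using Y[OF that] by (simp add: R_def)
  have [measurable]: "R \<in> borel_measurable M"
    unfolding R_def[abs_def] by measurable
  have RS: "R \<in> borel_measurable (S {1})"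
    unfolding R_def[abs_def] using VS[of "{1}"] by measurable
  \<comment> \<open>For \<open>V\<close> above 1 the radicand is negative and the square of
    \<open>R\<close> is its absolute value, so the identity for the square is claimed only almost
    everywhere.\<close>
  have "AE x in distr M borel V. 0 < x \<and> x < 1"
    unfolding V(2) by (rule AE_uniform_measureI) auto
  then have "AE \<omega> in M. 0 < V \<omega> \<and> V \<omega> < 1"
    by (subst (asm) AE_distr_iff) auto
  then have R2: "AE \<omega> in M. (R \<omega>)\<^sup>2 = - 2 * ln (V \<omega>)"
    by eventually_elim (auto simp: R_def)
  have "integrable M (\<lambda>\<omega>. - 2 * ln (V \<omega>))"
    using integrable_uniform_ln unfolding V(2)[symmetric] by (subst (asm) integrable_distr_eq) auto
  then have int_R2: "integrable M (\<lambda>\<omega>. (R \<omega>)\<^sup>2)"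
    by (subst integrable_cong_AE[OF _ _ R2]) measurable
  have int_R: "integrable M R"
    by (rule square_integrable_imp_integrable[OF _ int_R2]) simp
  have "(LINT \<omega>|M. (R \<omega>)\<^sup>2) = (LINT \<omega>|M. - 2 * ln (V \<omega>))"
    by (intro integral_cong_AE[OF _ _ R2]) measurable
  also have "\<dots> = 2"
    using integral_uniform_ln unfolding V(2)[symmetric] by (subst (asm) integral_distr) auto
  finally have E_R2: "(LINT \<omega>|M. (R \<omega>)\<^sup>2) = 2" .

  \<comment> \<open>Averaging over the phase and separating the radial factor\<close>
  have phase: "expectation (\<lambda>\<omega>. cos (k * \<Lambda> \<omega>)) = 0" "expectation (\<lambda>\<omega>. sin (k * \<Lambda> \<omega>)) = 0"
    if "0 < k" for k :: nat
  proof -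
    have "expectation (\<lambda>\<omega>. cos (k * \<Lambda> \<omega>)) = (LINT x|distr M borel \<Lambda>. cos (k * x))"
      by (subst integral_distr) auto
    then show "expectation (\<lambda>\<omega>. cos (k * \<Lambda> \<omega>)) = 0"
      by (simp add: \<Lambda>(2) integral_uniform_cos[OF that])
    have "expectation (\<lambda>\<omega>. sin (k * \<Lambda> \<omega>)) = (LINT x|distr M borel \<Lambda>. sin (k * x))"
      by (subst integral_distr) auto
    then show "expectation (\<lambda>\<omega>. sin (k * \<Lambda> \<omega>)) = 0"
      by (simp add: \<Lambda>(2) integral_uniform_sin[OF that])
  qed
  \<comment> \<open>The product of \<open>f\<close> and \<open>W\<close> uses sources 0 and 3 only,
    hence is independent of the phase, source 2.\<close>
  have E_phase: "expectation (\<lambda>\<omega>. cos (f \<omega> * W \<omega> + k * \<Lambda> \<omega>)) = 0"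
    if "0 < k" "f \<in> borel_measurable (S {0, 3})" for k :: nat and f
    using that WS[of "{0, 3}"] \<Lambda>S[of "{2}"]
    by (intro expectation_cos_add_indep phase indepI[of _ "{0, 3}" _ "{2}"]) auto
  have int_cos: "integrable M (\<lambda>\<omega>. cos (f \<omega>))" if "f \<in> borel_measurable M" for f :: "'w \<Rightarrow> real"
    using that by (intro integrable_const_bound[of _ 1]) auto
  \<comment> \<open>\<open>R\<close> depends on source 1 alone. The function \<open>g\<close> will
    be the identity for the mean and the square for the covariance.\<close>
  have factor:
      "integrable M (\<lambda>\<omega>. g (R \<omega>) * c \<omega>)" (is ?int)
      "expectation (\<lambda>\<omega>. g (R \<omega>) * c \<omega>) = expectation (\<lambda>\<omega>. g (R \<omega>)) * expectation c" (is ?eq)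
    if "integrable M (\<lambda>\<omega>. g (R \<omega>))" "g \<in> borel_measurable borel"
      "integrable M c" "c \<in> borel_measurable (S {0, 2, 3})" for g :: "real \<Rightarrow> real" and c
  proof -
    have "indep_var borel (\<lambda>\<omega>. g (R \<omega>)) borel c"
      using measurable_compose[OF RS that(2)] that(4) by (rule indepI) auto
    then show ?int ?eq
      using that(1,3) by (rule indep_var_integrable indep_var_lebesgue_integral)+
  qed
  note S023 = WS[of "{0, 2, 3}"] \<Lambda>S[of "{0, 2, 3}"] ZS[of "{0, 2, 3}"]

  \<comment> \<open>The mean of \<open>Y\<close>\<close>
  have Y_mean: "integrable M (Y u)" "expectation (Y u) = 0" if u: "u \<in> points G" for u
  proof -
    let ?c = "\<lambda>\<omega>. cos (Z u \<omega> * W \<omega> + \<Lambda> \<omega>)"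
    have c: "integrable M ?c" "?c \<in> borel_measurable (S {0, 2, 3})"
      using u S023 by (auto intro!: int_cos)
    have "expectation ?c = 0"
      using E_phase[of 1 "Z u"] ZS[of "{0, 3}" u] u by simp
    then have "integrable M (\<lambda>\<omega>. R \<omega> * ?c \<omega>)" "expectation (\<lambda>\<omega>. R \<omega> * ?c \<omega>) = 0"
      using factor[OF _ _ c, of "\<lambda>r. r"] int_R by simp_all
    then show "integrable M (Y u)" "expectation (Y u) = 0"
      by (simp_all add: Y_R u cong: Bochner_Integration.integrable_cong Bochner_Integration.integral_cong)
  qed

  \<comment> \<open>The covariance of \<open>Y\<close>\<close>
  have Y_prod: "integrable M (\<lambda>\<omega>. Y u \<omega> * Y v \<omega>)"
    "covariance M (Y u) (Y v) = (LINT \<omega>|F. exp (- (resistance_metric M Z u v * \<omega>\<^sup>2 / 2)))"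
    if u: "u \<in> points G" and v: "v \<in> points G" for u v
  proof -
    let ?d = "\<lambda>\<omega>. cos ((Z u \<omega> - Z v \<omega>) * W \<omega>)"
    let ?s = "\<lambda>\<omega>. cos ((Z u \<omega> + Z v \<omega>) * W \<omega> + 2 * \<Lambda> \<omega>)"
    let ?c = "\<lambda>\<omega>. (?d \<omega> + ?s \<omega>) / 2"
    have Y_eq: "Y u \<omega> * Y v \<omega> = (R \<omega>)\<^sup>2 * ?c \<omega>" if "\<omega> \<in> space M" for \<omega>
    proof -
      \<comment> \<open>Product-to-sum formula: the phases cancel in the difference of the arguments
        and add up to \<open>2 * \<Lambda>\<close> in their sum.\<close>
      have c: "cos (Z u \<omega> * W \<omega> + \<Lambda> \<omega>) * cos (Z v \<omega> * W \<omega> + \<Lambda> \<omega>) = ?c \<omega>"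
        by (simp add: cos_times_cos algebra_simps)
      have "Y u \<omega> * Y v \<omega> =
          (R \<omega>)\<^sup>2 * (cos (Z u \<omega> * W \<omega> + \<Lambda> \<omega>) * cos (Z v \<omega> * W \<omega> + \<Lambda> \<omega>))"
        using u v that by (simp add: Y_R power2_eq_square ac_simps)
      then show ?thesis
        unfolding c .
    qed
    have int: "integrable M ?d" "integrable M ?s"
      using u v by (auto intro!: int_cos)
    then have c: "integrable M ?c" "?c \<in> borel_measurable (S {0, 2, 3})"
      using u v S023 by auto
    have s: "expectation ?s = 0"
      using E_phase[of 2 "\<lambda>\<omega>. Z u \<omega> + Z v \<omega>"] ZS[of "{0, 3}"] u v by simp
    obtain s where D: "centered_normal M (\<lambda>\<omega>. Z u \<omega> - Z v \<omega>) s"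
      using centered_normal_auxiliary_field_increment[OF G Z u v] by blast
    \<comment> \<open>The increment has mean 0, so its variance is its second moment
      \<open>s\<close>.\<close>
    then have "resistance_metric M Z u v = s"
      by (simp add: resistance_metric_def centered_normal_def)
    then have d: "expectation ?d = (LINT \<omega>|F. exp (- (resistance_metric M Z u v * \<omega>\<^sup>2 / 2)))"
      using expectation_cos_centered_normal_mult[OF D indepI[of _ "{0}" _ "{3}"]]
        ZS[of "{0}"] WS[of "{3}"] u v W(2) by simp
    show "integrable M (\<lambda>\<omega>. Y u \<omega> * Y v \<omega>)"
      using factor(1)[OF _ _ c, of "\<lambda>r. r\<^sup>2"] int_R2
      by (simp add: Y_eq cong: Bochner_Integration.integrable_cong)
    have "covariance M (Y u) (Y v) = expectation (\<lambda>\<omega>. Y u \<omega> * Y v \<omega>)"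
      using Y_mean u v by (simp add: covariance_def)
    also have "\<dots> = expectation (\<lambda>\<omega>. (R \<omega>)\<^sup>2 * ?c \<omega>)"
      by (intro Bochner_Integration.integral_cong Y_eq) auto
    \<comment> \<open>The second moment 2 of \<open>R\<close> cancels the factor 1/2 in
      \<open>?c\<close>.\<close>
    also have "\<dots> = expectation ?d + expectation ?s"
      using factor(2)[OF _ _ c, of "\<lambda>r. r\<^sup>2"] int_R2 E_R2 int by simp
    finally show "covariance M (Y u) (Y v) = (LINT \<omega>|F. exp (- (resistance_metric M Z u v * \<omega>\<^sup>2 / 2)))"
      by (simp add: s d)
  qed
  then have "isotropic_wrt (points G) (resistance_metric M Z) (\<lambda>u v. covariance M (Y u) (Y v))"
    unfolding isotropic_wrt_def
    by (intro exI[of _ "\<lambda>d. LINT \<omega>|F. exp (- (d * \<omega>\<^sup>2 / 2))"]) simp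
  with Y_mean Y_prod show ?thesis
    by simp
qed

end
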